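(* Let $m\in\mathcal{S}'$, i.e. $m$ is a positive integer admitting an $s$-decomposition. Then: (i) Every $s$-decomposition of $m$ has at least two factors, and $m$ has at least two distinct prime divisors. (ii) If $m=g_1^{e_1}g_2^{e_2}$ is an $s$-decomposition of $m$ (with two factors), then $e_1+e_2\ge 3$. (iii) If $m$ has an $s$-decomposition of the form $m=g_1 g_2 g_3$ where $g_1,g_2,g_3$ are odd primes, then this is the only $s$-decomposition of $m$. In particular, if in addition $m\in\mathcal{S}$, then $m\in\mathcal{C}'_3$. (iv) If $m$ has an $s$-decomposition $m=g_1\cdots g_n$ with $n\ge 3$ where all $g_\nu$ are odd primes, then $m\in\mathcal{H}$. Moreover, if $g_1\cdots g_n$ is a strict $s$-decomposition of $m$, then $m\in\mathcal{C}'_n$. (v) If $m=g_1^{e_1}\cdots g_n^{e_n}$ with $n\ge 2$ is an $s$-decomposition of $m$, then each factor satisfies $1<g_\nu<m^{1/(\operatorname{ord}_{g_\nu}(m)+1)}\le m^{1/(e_\nu+1)}\le\sqrt{m}$.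
   Context: For an integer base $g\ge 2$ and integer $m\ge 0$, $s_g(m)$ denotes the sum of the base-$g$ digits of $m$; by convention $s_1(m):=0$. For integers $g\ge2$, $m\ge1$, $\operatorname{ord}_g(m):=\max\{n\ge0: g^n\mid m\}$. A positive integer $m$ has an $s$-decomposition if $m=\prod_{\nu=1}^n g_\nu^{e_\nu}$ with exponents $e_\nu\ge1$ and proper factors $g_\nu$ of $m$ (i.e. $1<g_\nu<m$) that are strictly increasing $g_1<\dots<g_n$ (not necessarily coprime), such that $s_{g_\nu}(m)\ge g_\nu$ for each $\nu$; it is a strict $s$-decomposition if $s_{g_\nu}(m)=g_\nu$ for each $\nu$. $\mathcal{S}'$ (resp. $\mathcal{S}$) is the set of positive integers having an $s$-decomposition (resp. a strict $s$-decomposition). $\mathcal{H}$ is the set of squarefree integers $m>1$ such that $s_p(m)\ge p$ for every prime $p\mid m$. $\mathcal{C}'$ (primary Carmichael numbers) is the set of squarefree integers $m>1$ such that $s_p(m)=p$ for every prime $p\mid m$, and $\mathcal{C}'_n$ is the subset of those with exactly $n$ prime factors. *)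

theory Defs
  imports Complex_Main "HOL-Computational_Algebra.Computational_Algebra"
begin

text \<open>Sum of the base-\<open>g\<close> digits of \<open>m\<close>. The guard \<open>g \<le> 1\<close> implements the convention
  \<open>s\<^sub>1(m) = 0\<close>; the value at \<open>g = 0\<close> is irrelevant.\<close>

function digit_sum :: "nat \<Rightarrow> nat \<Rightarrow> nat" where
  "digit_sum g m = (if g \<le> 1 \<or> m = 0 then 0 else m mod g + digit_sum g (m div g))"
  by pat_completeness auto
termination
  by (relation "measure snd") auto

declare digit_sum.simps [simp del]

text \<open>A factorization \<open>m = g\<^sub>1^e\<^sub>1 \<cdots> g\<^sub>n^e\<^sub>n\<close> is represented by the list
  \<open>[(g\<^sub>1, e\<^sub>1), \<dots>, (g\<^sub>n, e\<^sub>n)]\<close>. The list must be nonempty, which excludes the empty product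
  for \<open>m = 1\<close>. That each \<open>g\<^sub>\<nu>\<close> divides \<open>m\<close> follows from the product formula and \<open>e\<^sub>\<nu> \<ge> 1\<close>.\<close>

definition s_decomposition :: "nat \<Rightarrow> (nat \<times> nat) list \<Rightarrow> bool" where
  "s_decomposition m ds \<longleftrightarrow>
     ds \<noteq> [] \<and>
     m = (\<Prod>(g, e) \<leftarrow> ds. g ^ e) \<and>
     sorted_wrt (<) (map fst ds) \<and>
     (\<forall>(g, e) \<in> set ds. 1 \<le> e \<and> 1 < g \<and> g < m \<and> g \<le> digit_sum g m)"

definition strict_s_decomposition :: "nat \<Rightarrow> (nat \<times> nat) list \<Rightarrow> bool" where
  "strict_s_decomposition m ds \<longleftrightarrow>
     s_decomposition m ds \<and> (\<forall>(g, e) \<in> set ds. digit_sum g m = g)"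

definition s_decomposable :: "nat set" ("\<S>''") where
  "\<S>' = {m. 0 < m \<and> (\<exists>ds. s_decomposition m ds)}"

definition strict_s_decomposable :: "nat set" ("\<S>") where
  "\<S> = {m. 0 < m \<and> (\<exists>ds. strict_s_decomposition m ds)}"

definition H_numbers :: "nat set" ("\<H>") where
  "\<H> = {m. 1 < m \<and> squarefree m \<and> (\<forall>p. prime p \<and> p dvd m \<longrightarrow> p \<le> digit_sum p m)}"

definition primary_carmichael :: "nat set" ("\<C>''") where
  "\<C>' = {m. 1 < m \<and> squarefree m \<and> (\<forall>p. prime p \<and> p dvd m \<longrightarrow> digit_sum p m = p)}"

definition primary_carmichael_with :: "nat \<Rightarrow> nat set" where
  "primary_carmichael_with n = {m \<in> \<C>'. card (prime_factors m) = n}"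

end

theory Submission
  imports Defs
begin

text \<open>Trailing zero digits do not contribute to \<open>s\<^sub>g(m)\<close>. Writing \<open>m = g\<^sup>k m'\<close> with
  \<open>g\<close> not dividing \<open>m'\<close>, the condition \<open>s\<^sub>g(m) \<ge> g\<close> therefore gives \<open>g \<le> s\<^sub>g(m') \<le> m'\<close>, and
  \<open>m' \<noteq> g\<close>, so \<open>g ^ (k + 1) < m\<close>. All five parts follow from this single inequality; in
  part (iii) it forces every factor of a decomposition of \<open>pqr\<close> to be one of the three primes.\<close>

section \<open>Digit sums and the size of a base\<close>

lemma digit_sum_mult_base:
  assumes "1 < g"
  shows "digit_sum g (g * m) = digit_sum g m"
  using assms by (cases "m = 0") (simp_all add: digit_sum.simps[of g "g * m"])

lemma digit_sum_power_mult:
  assumes "1 < g"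
  shows "digit_sum g (g ^ k * m) = digit_sum g m"
  by (induction k) (use assms in \<open>simp_all add: digit_sum_mult_base mult.assoc\<close>)

lemma digit_sum_le: "digit_sum g m \<le> m"
proof (induction g m rule: digit_sum.induct)
  case (1 g m)
  show ?case
  proof (cases "g \<le> 1 \<or> m = 0")
    case True
    then show ?thesis by (simp add: digit_sum.simps)
  next
    case False
    then have "digit_sum g m \<le> m mod g + m div g"
      using 1 by (simp add: digit_sum.simps[of g m])
    also have "\<dots> \<le> m mod g + g * (m div g)"
      using False by (intro add_left_mono) simp
    also have "\<dots> = m"
      by (rule mod_mult_div_eq)
    finally show ?thesis .
  qed
qed

text \<open>Stated for the cofactor because the prime power case below needs that \<open>g\<close>
  does not divide \<open>m'\<close>, which the inequality between powers forgets.\<close>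

lemma base_less_cofactor:
  assumes "1 < g" "0 < m" "g \<le> digit_sum g m"
  obtains m' where "m = g ^ multiplicity g m * m'" "\<not> g dvd m'" "g < m'"
proof -
  obtain m' where m': "m = g ^ multiplicity g m * m'" "\<not> g dvd m'"
    using multiplicity_decompose'[of m g] assms by auto
  have "g \<le> digit_sum g m'"
    using assms digit_sum_power_mult m'(1) by metis
  then have "g \<le> m'"
    using digit_sum_le le_trans by blast
  moreover have "m' \<noteq> g"
    using m'(2) by auto
  ultimately show thesis
    using that m' by auto
qed

lemma power_Suc_multiplicity_less:
  assumes "1 < g" "0 < m" "g \<le> digit_sum g m"
  shows "g ^ Suc (multiplicity g m) < m"
proof -
  obtain m' where "m = g ^ multiplicity g m * m'" "g < m'"
    using base_less_cofactor assms by metis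
  then show ?thesis
    using assms(1) by (metis mult.commute mult_less_mono1 power_Suc zero_less_power
        less_trans zero_less_one)
qed

section \<open>Bounds for a single factor of a decomposition\<close>

lemma power_factor_dvd:
  assumes "s_decomposition m ds" "(g, e) \<in> set ds"
  shows "g ^ e dvd m"
proof -
  have "g ^ e \<in> set (map (\<lambda>(g, e). g ^ e) ds)"
    using assms(2) by force
  then show ?thesis
    using assms(1) by (metis s_decomposition_def prod_list_dvd)
qed

text \<open>The exponent \<open>e\<close> is only bounded by the multiplicity: the factors need not
  be coprime, so the others can contribute further powers of \<open>g\<close>.\<close>

lemma s_decomposition_factor:
  assumes "s_decomposition m ds" "(g, e) \<in> set ds"
  shows "1 \<le> e" "1 < g" "g < m" "g \<le> digit_sum g m"
    "e \<le> multiplicity g m" "g ^ Suc (multiplicity g m) < m" "g dvd m"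
proof -
  show 1: "1 \<le> e" "1 < g" "g < m" "g \<le> digit_sum g m"
    using assms unfolding s_decomposition_def by auto
  have dvd: "g ^ e dvd m"
    by (rule power_factor_dvd[OF assms])
  then show "e \<le> multiplicity g m"
    using 1 by (intro multiplicity_geI) auto
  show "g ^ Suc (multiplicity g m) < m"
    using 1 by (intro power_Suc_multiplicity_less) auto
  show "g dvd m"
    using dvd 1 dvd_power[of e g] dvd_trans by fastforce
qed

lemma power_Suc_exponent_less:
  assumes "s_decomposition m ds" "(g, e) \<in> set ds"
  shows "g ^ Suc e < m"
proof -
  have "g ^ Suc e \<le> g ^ Suc (multiplicity g m)"
    using s_decomposition_factor[OF assms] by (intro power_increasing) auto
  then show ?thesis
    using s_decomposition_factor(6)[OF assms] by linarith
qed

text \<open>Since \<open>e\<close> is at least 1, this holds uniformly in the exponents; parts (ii)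
  and (iii) need no sharper size bound.\<close>

lemma square_factor_less:
  assumes "s_decomposition m ds" "(g, e) \<in> set ds"
  shows "g * g < m"
proof -
  have "g ^ 2 \<le> g ^ Suc e"
    using s_decomposition_factor[OF assms] by (intro power_increasing) auto
  then show ?thesis
    using power_Suc_exponent_less[OF assms] unfolding power2_eq_square by linarith
qed

section \<open>Number of factors and of prime divisors\<close>

text \<open>A single factor would give m = g^e, against g^(e+1) < m.\<close>

lemma s_decomposition_length_ge_2:
  assumes "s_decomposition m ds"
  shows "2 \<le> length ds"
proof (rule ccontr)
  assume "\<not> 2 \<le> length ds"
  moreover have "ds \<noteq> []"
    using assms by (simp add: s_decomposition_def)
  ultimately obtain g e where ds: "ds = [(g, e)]"
    by (cases ds) (auto simp: Suc_le_eq)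
  then have "m = g ^ e" "g ^ Suc e < m" "1 < g"
    using assms power_Suc_exponent_less[OF assms] s_decomposition_factor(2)[OF assms]
    by (auto simp: s_decomposition_def)
  then show False
    by simp
qed

text \<open>Divisors of a prime power are totally ordered by divisibility. A cofactor
  \<open>m'\<close> that \<open>g\<close> does not divide is thus a smaller power of
  \<open>p\<close> than \<open>g\<close>, which contradicts g < m'.\<close>

lemma not_base_le_digit_sum_prime_power:
  assumes "prime p" "g dvd p ^ a" "1 < g"
  shows "digit_sum g (p ^ a) < g"
proof (rule ccontr)
  assume "\<not> digit_sum g (p ^ a) < g"
  then have "g \<le> digit_sum g (p ^ a)"
    by simp
  moreover have "0 < p ^ a"
    using assms(1) prime_gt_0_nat by simp
  ultimately obtain m' where m':
    "p ^ a = g ^ multiplicity g (p ^ a) * m'" "\<not> g dvd m'" "g < m'"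
    using base_less_cofactor assms(3) by blast
  obtain b where b: "g = p ^ b"
    using assms divides_primepow_nat by blast
  have "m' dvd p ^ a"
    by (subst m'(1)) simp
  then obtain c where c: "m' = p ^ c"
    using assms divides_primepow_nat by blast
  have "c < b"
    using m'(2) b c le_imp_power_dvd not_less by metis
  then have "m' \<le> g"
    using b c prime_gt_0_nat[OF assms(1)] by (simp add: power_increasing)
  then show False
    using m'(3) by simp
qed

text \<open>Having two factors does not suffice, as distinct factors such as 2 and 4 may share their
  only prime. Instead any one factor shows that \<open>m\<close> is not a prime power.\<close>

lemma s_decomposition_card_prime_factors:
  assumes "s_decomposition m ds"
  shows "2 \<le> card (prime_factors m)"
proof (rule ccontr)
  assume less: "\<not> 2 \<le> card (prime_factors m)"
  obtain g e where ge: "(g, e) \<in> set ds"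
    using assms by (cases ds) (auto simp: s_decomposition_def)
  note g = s_decomposition_factor[OF assms ge]
  have "1 < m"
    using g by linarith
  then obtain p where p: "prime p" "p dvd m"
    by (metis less_irrefl prime_factor_nat)
  then have "p \<in> prime_factors m"
    using \<open>1 < m\<close> by (auto simp: in_prime_factors_iff)
  moreover have "card (prime_factors m) \<le> Suc 0"
    using less by simp
  ultimately have "prime_factors m = {p}"
    using card_le_Suc0_iff_eq[of "prime_factors m"] by auto
  then have "m = p ^ multiplicity p m"
    using prime_factorization_nat[of m] \<open>1 < m\<close> by simp
  then have "digit_sum g m < g"
    using not_base_le_digit_sum_prime_power[OF p(1)] g(2,7) by metis
  then show False
    using g(4) by simp
qed

section \<open>Decompositions into primes\<close>

text \<open>The bases are exactly the primes dividing \<open>m\<close>, the strict order fixes their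
  arrangement, and squarefreeness forces exponent 1. Writing the list in terms of \<open>m\<close>
  alone makes any two prime decompositions equal.\<close>

lemma prime_s_decomposition_unique:
  assumes "s_decomposition m ds" "squarefree m" "\<And>g. g \<in> set (map fst ds) \<Longrightarrow> prime g"
  shows "ds = map (\<lambda>g. (g, 1)) (sorted_list_of_set (prime_factors m))"
proof -
  have m: "m = (\<Prod>(g, e) \<leftarrow> ds. g ^ e)"
    and sorted: "sorted_wrt (<) (map fst ds)"
    using assms(1) by (auto simp: s_decomposition_def)
  have "m \<noteq> 0"
    using assms(2) by (metis not_squarefree_0)
  have "set (map fst ds) = prime_factors m"
  proof (intro equalityI subsetI)
    fix g assume g: "g \<in> set (map fst ds)"
    then obtain e where "(g, e) \<in> set ds"
      by auto
    then show "g \<in> prime_factors m"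
      using s_decomposition_factor(7)[OF assms(1)] assms(3)[OF g] \<open>m \<noteq> 0\<close>
      by (auto simp: in_prime_factors_iff)
  next
    fix p assume "p \<in> prime_factors m"
    then have p: "prime p" "p dvd (\<Prod>(g, e) \<leftarrow> ds. g ^ e)"
      using m by (auto simp: in_prime_factors_iff)
    then obtain g e where ge: "(g, e) \<in> set ds" "p dvd g ^ e"
      using prime_dvd_prod_mset_iff[of p "mset (map (\<lambda>(g, e). g ^ e) ds)"]
      by (auto simp: prod_mset_prod_list simp flip: mset_map)
    have "p dvd g"
      using p(1) ge(2) by (rule prime_dvd_power)
    moreover have "prime g"
      using assms(3) ge(1) image_eqI[of g fst "(g, e)"] by simp
    ultimately have "p = g"
      using p(1) primes_dvd_imp_eq by blast
    then show "p \<in> set (map fst ds)"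
      using ge(1) by force
  qed
  then have "map fst ds = sorted_list_of_set (prime_factors m)"
    using sorted by (metis sorted_list_of_set.idem_if_sorted_distinct strict_sorted_iff)
  moreover have "ds = map (\<lambda>g. (g, 1)) (map fst ds)"
  proof -
    have "(fst x, 1) = x" if "x \<in> set ds" for x
    proof -
      obtain g e where x: "x = (g, e)"
        by fastforce
      have "e \<le> multiplicity g m"
        using s_decomposition_factor(5) assms(1) that x by blast
      also have "\<dots> \<le> 1"
        using assms(2,3) that x squarefree_factorial_semiring'[OF \<open>m \<noteq> 0\<close>]
          not_dvd_imp_multiplicity_0[of g m]
        by (cases "g dvd m") (force simp: in_prime_factors_iff \<open>m \<noteq> 0\<close>)+
      finally show ?thesis
        using s_decomposition_factor(1)[OF assms(1)] that x by fastforce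
    qed
    then show ?thesis
      by (simp add: map_idI)
  qed
  ultimately show ?thesis
    by simp
qed

lemma squarefree_prod_list_primes:
  assumes "distinct ps" "\<And>p. p \<in> set ps \<Longrightarrow> prime p"
  shows "squarefree (prod_list ps :: nat)"
  using assms
proof (induction ps)
  case (Cons p ps)
  have "coprime p (prod_list ps)"
  proof (rule prime_imp_coprime)
    show "\<not> p dvd prod_list ps"
    proof
      assume "p dvd prod_list ps"
      then obtain q where "q \<in> set ps" "p dvd q"
        using Cons.prems prime_dvd_prod_mset_iff[of p "mset ps"]
        by (auto simp: prod_mset_prod_list)
      then show False
        using Cons.prems primes_dvd_imp_eq[of p q] by auto
    qed
  qed (use Cons.prems in auto)
  then show ?case
    using Cons by (simp add: squarefree_mult_coprime squarefree_prime)
qed simp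

lemma squarefree_if_prime_s_decomposition:
  assumes "s_decomposition m (map (\<lambda>g. (g, 1)) gs)" "\<forall>g \<in> set gs. prime g"
  shows "squarefree m" "prime_factors m = set gs" "distinct gs"
proof -
  have sorted: "sorted_wrt (<) gs" and m: "m = prod_list gs"
    using assms(1) by (auto simp: s_decomposition_def comp_def)
  then show distinct: "distinct gs"
    by (simp add: strict_sorted_iff)
  show sf: "squarefree m"
    using squarefree_prod_list_primes assms(2) distinct m by blast
  \<comment> \<open>Uniqueness is applied to the given decomposition itself, in order to read off
    the prime factors of \<open>m\<close> from \<open>gs\<close>.\<close>
  have "map (\<lambda>g. (g, 1)) gs = map (\<lambda>g. (g, 1::nat)) (sorted_list_of_set (prime_factors m))"
    using assms by (intro prime_s_decomposition_unique[OF _ sf]) auto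
  then have "gs = sorted_list_of_set (prime_factors m)"
    by (auto dest: map_injective simp: inj_def)
  then show "prime_factors m = set gs"
    by simp
qed

text \<open>Once the factors are known to be all the primes dividing \<open>m\<close>, the digit
  condition on factors becomes the one on primes. The strict case below is the same with
  equality.\<close>

lemma prime_s_decomposition_imp_H_numbers:
  assumes "s_decomposition m (map (\<lambda>g. (g, 1)) gs)" "\<forall>g \<in> set gs. prime g"
  shows "m \<in> \<H>"
proof -
  note sf = squarefree_if_prime_s_decomposition[OF assms]
  have "1 < m"
    using assms(1) s_decomposition_factor(2,3) less_trans
    by (metis list.set_intros(1) list.exhaust s_decomposition_def surj_pair)
  moreover have "p \<le> digit_sum p m" if "prime p" "p dvd m" for p
  proof -
    have "p \<in> set gs"
      using that \<open>1 < m\<close> sf(2) by (auto simp flip: sf(2) simp: in_prime_factors_iff)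
    then show ?thesis
      using assms(1) by (auto simp: s_decomposition_def)
  qed
  ultimately show ?thesis
    using sf(1) by (auto simp: H_numbers_def)
qed

lemma strict_prime_s_decomposition_imp_primary_carmichael:
  assumes "strict_s_decomposition m (map (\<lambda>g. (g, 1)) gs)" "\<forall>g \<in> set gs. prime g"
  shows "m \<in> primary_carmichael_with (length gs)"
proof -
  have dec: "s_decomposition m (map (\<lambda>g. (g, 1)) gs)"
    using assms(1) by (simp add: strict_s_decomposition_def)
  note sf = squarefree_if_prime_s_decomposition[OF dec assms(2)]
  have "1 < m"
    using prime_s_decomposition_imp_H_numbers[OF dec assms(2)] by (simp add: H_numbers_def)
  moreover have "digit_sum p m = p" if "prime p" "p dvd m" for p
  proof -
    have "p \<in> set gs"
      using that \<open>1 < m\<close> by (auto simp flip: sf(2) simp: in_prime_factors_iff)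
    then show ?thesis
      using assms(1) by (auto simp: strict_s_decomposition_def)
  qed
  moreover have "card (prime_factors m) = length gs"
    using sf(2,3) distinct_card by metis
  ultimately show ?thesis
    using sf(1) by (auto simp: primary_carmichael_with_def primary_carmichael_def)
qed

section \<open>Products of three primes\<close>

lemma divisor_of_three_primes_cases:
  fixes p q r :: nat
  assumes "prime p" "prime q" "prime r" "g dvd p * q * r"
  shows "g \<in> {1, p, q, r, p * q, p * r, q * r, p * q * r}"
proof -
  obtain a b where ab: "g = a * b" "a dvd p * q" "b dvd r"
    using assms(4) division_decomp by blast
  obtain c d where "a = c * d" "c dvd p" "d dvd q"
    using ab(2) division_decomp by blast
  then have "g = c * d * b" "c = 1 \<or> c = p" "d = 1 \<or> d = q" "b = 1 \<or> b = r"
    using ab assms(1-3) by (auto simp: prime_nat_iff)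
  then show ?thesis
    by auto
qed

text \<open>The square bound acts twice: on the three primes it says that each is smaller than the
  product of the other two, and on \<open>g\<close> it then excludes every product of two of
  them.\<close>

lemma three_primes_s_decomposition_factor:
  fixes p q r :: nat
  assumes "s_decomposition m [(p, 1), (q, 1), (r, 1)]" "prime p" "prime q" "prime r"
    and "g dvd m" "1 < g" "g * g < m"
  shows "prime g"
proof -
  have m: "m = p * q * r"
    using assms(1) by (simp add: s_decomposition_def mult.assoc)
  have "p * p < m" "q * q < m" "r * r < m"
    using square_factor_less[OF assms(1)] by auto
  then have less: "p < q * r" "q < p * r" "r < p * q"
    unfolding m by (auto simp: mult.assoc mult.left_commute[of p] mult.commute[of p q]
        dest: mult_less_cancel1[THEN iffD1] mult_less_cancel2[THEN iffD1])
  have "g \<in> {1, p, q, r, p * q, p * r, q * r, p * q * r}"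
    using divisor_of_three_primes_cases assms(2-5) m by blast
  \<comment> \<open>If \<open>h * k\<close> exceeds its cofactor \<open>l\<close>, then its square
    exceeds m = hkl. The facts \<open>less\<close> provide l < hk for each choice of
    \<open>l\<close> among the primes.\<close>
  moreover have "g \<noteq> h * k" if "l < h * k" "m = h * k * l" for h k l
    using assms(7) that by (metis mult_less_cancel1 order_less_asym)
  moreover have "g \<noteq> p * q * r"
    using assms(6,7) m by auto
  ultimately have "g \<in> {p, q, r}"
    using less assms(6) m by (auto simp: ac_simps)
  then show ?thesis
    using assms(2-4) by auto
qed

text \<open>Every factor of a competing decomposition is prime by the preceding lemma, so both lists
  equal the canonical one of the squarefree number \<open>m\<close>.\<close>

lemma three_primes_s_decomposition_unique:
  assumes "s_decomposition m [(p, 1), (q, 1), (r, 1)]" "prime p" "prime q" "prime r"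
    and "s_decomposition m ds"
  shows "ds = [(p, 1), (q, 1), (r, 1)]"
proof -
  have "squarefree m"
    using squarefree_if_prime_s_decomposition(1)[of m "[p, q, r]"] assms by simp
  moreover have "prime g" if g: "g \<in> set (map fst ds)" for g
  proof -
    obtain e where "(g, e) \<in> set ds"
      using g by auto
    then show ?thesis
      using three_primes_s_decomposition_factor[OF assms(1-4)]
        s_decomposition_factor(2,7)[OF assms(5)] square_factor_less[OF assms(5)] by metis
  qed
  moreover have "prime g" if "g \<in> set (map fst [(p, 1::nat), (q, 1), (r, 1)])" for g
    using that assms(2-4) by auto
  ultimately show ?thesis
    using prime_s_decomposition_unique assms(1,5) by metis
qed

section \<open>Two factors, and real bounds\<close>

text \<open>If both exponents were 1, the larger factor would have a square above g1 g2 = m.\<close>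

lemma s_decomposition_two_factors_exponents:
  assumes dec: "s_decomposition m [(g1, e1), (g2, e2)]"
  shows "3 \<le> e1 + e2"
proof (rule ccontr)
  assume "\<not> 3 \<le> e1 + e2"
  moreover have "1 \<le> e1" "1 \<le> e2"
    using s_decomposition_factor(1)[OF dec] by auto
  ultimately have "e1 = 1" "e2 = 1"
    by linarith+
  then have "m = g1 * g2" "g1 < g2"
    using dec by (simp_all add: s_decomposition_def)
  moreover have "g2 * g2 < m"
    using square_factor_less[OF dec] by auto
  ultimately show False
    by (simp add: mult_less_cancel2)
qed

text \<open>Here \<open>multiplicity g m\<close> is ord_g(m), also for composite \<open>g\<close>;
  call it k. The first bound is the (k+1)-th root of g^(k+1) < m. The others compare exponents over
  the base m > 1, using e \<le> k and 1 \<le> e.\<close>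

lemma s_decomposition_factor_bounds:
  assumes "s_decomposition m ds" "(g, e) \<in> set ds"
  shows "real g < real m powr (1 / (real (multiplicity g m) + 1))"
    and "real m powr (1 / (real (multiplicity g m) + 1)) \<le> real m powr (1 / (real e + 1))"
    and "real m powr (1 / (real e + 1)) \<le> sqrt (real m)"
proof -
  note g = s_decomposition_factor[OF assms]
  let ?k = "multiplicity g m"
  have root: "(real g powr (real ?k + 1)) powr (1 / (real ?k + 1)) = real g"
    using g(2) by (simp only: powr_powr) simp
  have "real g powr (real ?k + 1) = real (g ^ Suc ?k)"
    using g(2) powr_realpow[of "real g" "Suc ?k"] by (simp add: add.commute)
  also have "\<dots> < real m"
    using g(6) by (simp only: of_nat_less_iff)
  finally have "(real g powr (real ?k + 1)) powr (1 / (real ?k + 1)) < real m powr (1 / (real ?k + 1))"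
    by (intro powr_less_mono2) auto
  then show "real g < real m powr (1 / (real ?k + 1))"
    by (simp only: root)
  show "real m powr (1 / (real ?k + 1)) \<le> real m powr (1 / (real e + 1))"
    using g(2,3,5) by (intro powr_mono frac_le) auto
  have "real m powr (1 / (real e + 1)) \<le> real m powr (1 / 2)"
    using g(1,2,3) by (intro powr_mono frac_le) auto
  then show "real m powr (1 / (real e + 1)) \<le> sqrt (real m)"
    by (simp add: powr_half_sqrt)
qed

theorem theorem2p1:
  fixes m :: nat
  assumes "m \<in> \<S>'"
  shows
    "((\<forall>ds. s_decomposition m ds \<longrightarrow> 2 \<le> length ds) \<and> 2 \<le> card (prime_factors m)) \<and>
     (\<forall>g1 e1 g2 e2. s_decomposition m [(g1, e1), (g2, e2)] \<longrightarrow> 3 \<le> e1 + e2) \<and>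
     (\<forall>g1 g2 g3.
        s_decomposition m [(g1, 1), (g2, 1), (g3, 1)] \<and>
        prime g1 \<and> odd g1 \<and> prime g2 \<and> odd g2 \<and> prime g3 \<and> odd g3 \<longrightarrow>
          (\<forall>ds. s_decomposition m ds \<longrightarrow> ds = [(g1, 1), (g2, 1), (g3, 1)]) \<and>
          (m \<in> \<S> \<longrightarrow> m \<in> primary_carmichael_with 3)) \<and>
     (\<forall>n gs.
        3 \<le> n \<and> length gs = n \<and> (\<forall>g \<in> set gs. prime g \<and> odd g) \<and>
        s_decomposition m (map (\<lambda>g. (g, 1)) gs) \<longrightarrow>
          m \<in> \<H> \<and>
          (strict_s_decomposition m (map (\<lambda>g. (g, 1)) gs) \<longrightarrow> m \<in> primary_carmichael_with n)) \<and>
     (\<forall>ds. s_decomposition m ds \<and> 2 \<le> length ds \<longrightarrow>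
        (\<forall>(g, e) \<in> set ds.
           1 < g \<and>
           real g < real m powr (1 / (real (multiplicity g m) + 1)) \<and>
           real m powr (1 / (real (multiplicity g m) + 1)) \<le> real m powr (1 / (real e + 1)) \<and>
           real m powr (1 / (real e + 1)) \<le> sqrt (real m)))"
proof -
  \<comment> \<open>The bound on the number of prime divisors mentions no decomposition, so one is
    taken from membership in \<open>s_decomposable\<close>.\<close>
  obtain ds0 where ds0: "s_decomposition m ds0"
    using assms by (auto simp: s_decomposable_def)
  have "m \<in> primary_carmichael_with 3"
    if dec: "s_decomposition m [(p, 1), (q, 1), (r, 1)]" "prime p" "prime q" "prime r"
      and "m \<in> \<S>" for p q r
  proof -
    \<comment> \<open>The strict decomposition behind membership in
      \<open>strict_s_decomposable\<close> must, by uniqueness, be the given one, which is therefore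
      strict itself.\<close>
    obtain ds where strict: "strict_s_decomposition m ds"
      using \<open>m \<in> \<S>\<close> by (auto simp: strict_s_decomposable_def)
    then have "ds = [(p, 1), (q, 1), (r, 1)]"
      using three_primes_s_decomposition_unique[OF dec]
      by (simp add: strict_s_decomposition_def)
    then show ?thesis
      using strict strict_prime_s_decomposition_imp_primary_carmichael[of m "[p, q, r]"] dec(2-4)
      by (simp add: numeral_3_eq_3)
  qed
  note carmichael = this
  show ?thesis
  proof (intro conjI allI impI; (elim conjE)?)
    fix n :: nat and gs :: "nat list"
    assume gs: "length gs = n" "\<forall>g \<in> set gs. prime g \<and> odd g"
    then have prime: "\<forall>g \<in> set gs. prime g"
      by blast
    show "m \<in> \<H>" if "s_decomposition m (map (\<lambda>g. (g, 1)) gs)"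
      using prime_s_decomposition_imp_H_numbers[OF that prime] .
    show "m \<in> primary_carmichael_with n" if "strict_s_decomposition m (map (\<lambda>g. (g, 1)) gs)"
      using strict_prime_s_decomposition_imp_primary_carmichael[OF that prime] gs(1) by simp
  next
    fix ds assume "s_decomposition m ds"
    then show "\<forall>(g, e) \<in> set ds. 1 < g \<and>
        real g < real m powr (1 / (real (multiplicity g m) + 1)) \<and>
        real m powr (1 / (real (multiplicity g m) + 1)) \<le> real m powr (1 / (real e + 1)) \<and>
        real m powr (1 / (real e + 1)) \<le> sqrt (real m)"
      using s_decomposition_factor(2) s_decomposition_factor_bounds by blast
  qed (assumption | rule s_decomposition_length_ge_2 s_decomposition_card_prime_factors[OF ds0]
      s_decomposition_two_factors_exponents three_primes_s_decomposition_unique carmichael)+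
qed

end
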